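(* Let $(x_*,u_* )\in\mathbb{R}^n\times\mathbb{R}^m$ be a feasible point of the steady-state optimization problem $$\min_{x,u}\ \Phi(x)\quad\text{s.t.}\quad x=w(u),\ h(x)\ge0,\ b(u)\ge0 .$$ Then $(x_*,u_* )\in\bigcap_{i=0}^r\mathcal{S}_i$.
   Context: Plant: $\dot\xi=f(\xi,\upsilon)$ with $f:\mathbb{R}^n\times\mathbb{R}^m\to\mathbb{R}^n$. Assumption 1 (used to define $w$): for every constant input $\upsilon\equiv u$ the system has a unique globally exponentially stable equilibrium; it is denoted $w(u)$, giving a map $w:\mathbb{R}^m\to\mathbb{R}^n$ with $f(w(u),u)=0$. Data: $\Phi,h:\mathbb{R}^n\to\mathbb{R}$, $b:\mathbb{R}^m\to\mathbb{R}$. Fix $\beta>0$ and set $h_0(x,u)=h(x)$, $h_i(x,u)=\frac{\partial h_{i-1}}{\partial x}(x,u)f(x,u)+\beta h_{i-1}(x,u)$ for $i\ge1$ (with $\frac{\partial h_{i-1}}{\partial x}$ a row vector). Let $\mathcal{S}=\{(x,u): h(x)\ge0,\ b(u)\ge0\}$ and $\mathcal{S}_i=\{(x,u): b(u)\ge0,\ h_i(x,u)\ge0\}$ for $i\ge0$, so $\mathcal{S}_0=\mathcal{S}$. Assumption 2 (standing, fixes $r$): (1) there is an integer $r\ge1$ such that $f$ is $(r+1)$-times and $h$ is $(r+2)$-times continuously differentiable; $\mathcal{S}_r\ne\emptyset$; $\frac{\partial h_r}{\partial u}(x,u)\ne0$ for all $(x,u)\in\mathcal{S}_r$ with $h_r(x,u)=0$;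 and $\frac{\partial h_i}{\partial u}(x,u)=0$ for all $(x,u)\in\mathcal{S}_r$ and all $i<r$. (2) $b$ is twice continuously differentiable, and $b(u)=0$ implies $\nabla b(u)\neq0$ for all $(x,u)\in\mathcal{S}$. (3) $\Phi$ and $w$ are twice continuously differentiable. *)

theory Defs
  imports "HOL-Analysis.Analysis"
begin

section \<open>Smoothness and gradients\<close>

text \<open>\<open>k\<close>-times continuous differentiability on the whole space: in finite dimension,
  continuity of the derivative as an operator-valued map is the same as continuity of all
  directional derivatives.\<close>

primrec cont_diff :: "nat \<Rightarrow> ('a::euclidean_space \<Rightarrow> 'b::euclidean_space) \<Rightarrow> bool" where
  "cont_diff 0 g \<longleftrightarrow> continuous_on UNIV g"
| "cont_diff (Suc k) g \<longleftrightarrow> (\<forall>x. g differentiable (at x)) \<and>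
     (\<forall>v. cont_diff k (\<lambda>x. frechet_derivative g (at x) v))"

definition gradient :: "('a::euclidean_space \<Rightarrow> real) \<Rightarrow> 'a \<Rightarrow> 'a" where
  "gradient g x = (THE D. GDERIV g x :> D)"

lemma gradient_eqI:
  assumes "GDERIV g x :> D"
  shows "gradient g x = D"
  unfolding gradient_def
proof (rule the_equality)
  fix D' assume "GDERIV g x :> D'"
  then have "(\<lambda>v. v \<bullet> D') = (\<lambda>v. v \<bullet> D)"
    using assms unfolding gderiv_def by (rule has_derivative_unique)
  then have "v \<bullet> D' = v \<bullet> D" for v by meson
  then show "D' = D" by (metis vector_eq_rdot inner_commute)
qed (rule assms)

lemma frechet_derivative_eq_gradient:
  fixes g :: "'a::euclidean_space \<Rightarrow> real"
  assumes "g differentiable (at x)"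
  shows "frechet_derivative g (at x) v = gradient g x \<bullet> v"
proof -
  let ?D = "frechet_derivative g (at x)"
  let ?d = "\<Sum>i\<in>Basis. ?D i *\<^sub>R i"
  have der: "(g has_derivative ?D) (at x)"
    using assms frechet_derivative_works by blast
  then have lin: "linear ?D" by (rule has_derivative_linear)
  have eq: "?D v = v \<bullet> ?d" for v
  proof -
    have "?D v = ?D (\<Sum>i\<in>Basis. (v \<bullet> i) *\<^sub>R i)" by (simp add: euclidean_representation)
    also have "\<dots> = (\<Sum>i\<in>Basis. (v \<bullet> i) * ?D i)"
      by (simp add: linear_sum[OF lin] linear_scale[OF lin])
    also have "\<dots> = v \<bullet> ?d" by (simp add: inner_sum_right mult.commute)
    finally show ?thesis .
  qed
  then have "?D = (\<lambda>v. v \<bullet> ?d)" by blast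
  then have "GDERIV g x :> ?d" using der unfolding gderiv_def by metis
  then have "gradient g x = ?d" by (rule gradient_eqI)
  then show ?thesis using eq[of v] by (simp add: inner_commute)
qed

section \<open>Equilibria of the plant under constant inputs\<close>

definition plant_trajectory ::
    "(real ^ 'n \<Rightarrow> real ^ 'm \<Rightarrow> real ^ 'n) \<Rightarrow> real ^ 'm \<Rightarrow> (real \<Rightarrow> real ^ 'n) \<Rightarrow> bool" where
  "plant_trajectory f u \<xi> \<longleftrightarrow>
     (\<forall>t\<ge>0. (\<xi> has_vector_derivative f (\<xi> t) u) (at t within {0..}))"

text \<open>The existence conjunct is the forward completeness implicit in an estimate that holds
  for all \<open>t \<ge> 0\<close>; without it, plants with finite escape time would satisfy the bound
  vacuously.  The constants \<open>c\<close> and \<open>\<kappa>\<close> may depend on \<open>u\<close>, but not on the initial state.\<close>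

definition ges_equilibrium ::
    "(real ^ 'n \<Rightarrow> real ^ 'm \<Rightarrow> real ^ 'n) \<Rightarrow> real ^ 'm \<Rightarrow> real ^ 'n \<Rightarrow> bool" where
  "ges_equilibrium f u x\<^sub>e \<longleftrightarrow>
     f x\<^sub>e u = 0 \<and>
     (\<forall>x\<^sub>0. \<exists>\<xi>. plant_trajectory f u \<xi> \<and> \<xi> 0 = x\<^sub>0) \<and>
     (\<exists>c>0. \<exists>\<kappa>>0. \<forall>\<xi>. plant_trajectory f u \<xi> \<longrightarrow>
        (\<forall>t\<ge>0. norm (\<xi> t - x\<^sub>e) \<le> c * exp (- \<kappa> * t) * norm (\<xi> 0 - x\<^sub>e)))"

definition steady_state_map ::
    "(real ^ 'n \<Rightarrow> real ^ 'm \<Rightarrow> real ^ 'n) \<Rightarrow> real ^ 'm \<Rightarrow> real ^ 'n" where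
  "steady_state_map f u = (THE x. ges_equilibrium f u x)"

section \<open>The functions \<open>h\<^sub>i\<close> and the sets \<open>\<S>\<^sub>i\<close>\<close>

primrec hocbf ::
    "(real ^ 'n \<Rightarrow> real ^ 'm \<Rightarrow> real ^ 'n) \<Rightarrow> (real ^ 'n \<Rightarrow> real) \<Rightarrow> real \<Rightarrow> nat
      \<Rightarrow> real ^ 'n \<Rightarrow> real ^ 'm \<Rightarrow> real" where
  "hocbf f h \<beta> 0 = (\<lambda>x u. h x)"
| "hocbf f h \<beta> (Suc i) = (\<lambda>x u.
     gradient (\<lambda>y. hocbf f h \<beta> i y u) x \<bullet> f x u + \<beta> * hocbf f h \<beta> i x u)"

definition constraint_set ::
    "(real ^ 'n \<Rightarrow> real) \<Rightarrow> (real ^ 'm \<Rightarrow> real) \<Rightarrow> ((real ^ 'n) \<times> (real ^ 'm)) set" where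
  "constraint_set h b = {(x, u). h x \<ge> 0 \<and> b u \<ge> 0}"

definition hocbf_set ::
    "(real ^ 'n \<Rightarrow> real ^ 'm \<Rightarrow> real ^ 'n) \<Rightarrow> (real ^ 'n \<Rightarrow> real) \<Rightarrow> (real ^ 'm \<Rightarrow> real)
      \<Rightarrow> real \<Rightarrow> nat \<Rightarrow> ((real ^ 'n) \<times> (real ^ 'm)) set" where
  "hocbf_set f h b \<beta> i = {(x, u). b u \<ge> 0 \<and> hocbf f h \<beta> i x u \<ge> 0}"

lemma hocbf_set_0: "hocbf_set f h b \<beta> 0 = constraint_set h b"
  by (auto simp: hocbf_set_def constraint_set_def)

text \<open>Feasible points of: minimise \<open>\<Phi> x\<close> over \<open>(x, u)\<close> subject to \<open>x = w u\<close>, \<open>h x \<ge> 0\<close>,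
  \<open>b u \<ge> 0\<close>.  The objective does not enter feasibility.\<close>

definition steady_state_feasible ::
    "(real ^ 'm \<Rightarrow> real ^ 'n) \<Rightarrow> (real ^ 'n \<Rightarrow> real) \<Rightarrow> (real ^ 'm \<Rightarrow> real)
      \<Rightarrow> ((real ^ 'n) \<times> (real ^ 'm)) set" where
  "steady_state_feasible w h b = {(x, u). x = w u \<and> h x \<ge> 0 \<and> b u \<ge> 0}"

end

theory Submission
  imports Defs
begin

text \<open>At a steady state the term of \<open>h\<^sub>i\<close> that
  carries the gradient is paired with the zero vector, so the recursion degenerates to
  multiplication by \<open>\<beta>\<close> and \<open>h\<^sub>i = \<beta>\<^sup>i h\<close> there. As \<open>\<beta> > 0\<close>, the sign of \<open>h\<close>
  is inherited by every \<open>h\<^sub>i\<close>.\<close>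

lemma hocbf_at_zero_of_plant:
  assumes "f x u = 0"
  shows "hocbf f h \<beta> i x u = \<beta> ^ i * h x"
  by (induction i) (simp_all add: assms)

lemma steady_state_map_zero:
  assumes "\<exists>!x. ges_equilibrium f u x"
  shows "f (steady_state_map f u) u = 0"
proof -
  have "ges_equilibrium f u (steady_state_map f u)"
    unfolding steady_state_map_def by (rule theI'[OF assms])
  then show ?thesis
    unfolding ges_equilibrium_def by (rule conjunct1)
qed

theorem mainTheorem5:
  fixes f :: "real ^ 'n \<Rightarrow> real ^ 'm \<Rightarrow> real ^ 'n"
    and \<Phi> h :: "real ^ 'n \<Rightarrow> real"
    and b :: "real ^ 'm \<Rightarrow> real"
    and \<beta> :: real and r :: nat
    and x\<^sub>s :: "real ^ 'n" and u\<^sub>s :: "real ^ 'm"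
  assumes beta_pos: "\<beta> > 0"
    and equilibrium: "\<forall>u. \<exists>!x. ges_equilibrium f u x"
    and r_ge_1: "r \<ge> 1"
    and f_smooth: "cont_diff (r + 1) (\<lambda>(x, u). f x u)"
    and h_smooth: "cont_diff (r + 2) h"
    and S_r_nonempty: "hocbf_set f h b \<beta> r \<noteq> {}"
    and h_r_input: "\<forall>(x, u) \<in> hocbf_set f h b \<beta> r.
       hocbf f h \<beta> r x u = 0 \<longrightarrow> gradient (\<lambda>v. hocbf f h \<beta> r x v) u \<noteq> 0"
    and h_i_input: "\<forall>(x, u) \<in> hocbf_set f h b \<beta> r. \<forall>i<r.
       gradient (\<lambda>v. hocbf f h \<beta> i x v) u = 0"
    and b_smooth: "cont_diff 2 b"
    and b_regular: "\<forall>(x, u) \<in> constraint_set h b. b u = 0 \<longrightarrow> gradient b u \<noteq> 0"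
    and Phi_smooth: "cont_diff 2 \<Phi>"
    and w_smooth: "cont_diff 2 (steady_state_map f)"
    and feasible: "(x\<^sub>s, u\<^sub>s) \<in> steady_state_feasible (steady_state_map f) h b"
  shows "(x\<^sub>s, u\<^sub>s) \<in> (\<Inter>i\<in>{0..r}. hocbf_set f h b \<beta> i)"
proof -
  have x_eq: "x\<^sub>s = steady_state_map f u\<^sub>s" and h_nonneg: "h x\<^sub>s \<ge> 0" and b_nonneg: "b u\<^sub>s \<ge> 0"
    using feasible by (auto simp: steady_state_feasible_def)
  have steady: "f x\<^sub>s u\<^sub>s = 0"
    unfolding x_eq by (rule steady_state_map_zero[OF equilibrium[rule_format]])
  have "hocbf f h \<beta> i x\<^sub>s u\<^sub>s \<ge> 0" for i
    using h_nonneg beta_pos by (simp add: hocbf_at_zero_of_plant[of f, OF steady])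
  then show ?thesis
    using b_nonneg by (simp add: hocbf_set_def)
qed

end
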